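(* Let $\mathcal{B}$ be an infinite-dimensional reflexive Banach space over $\mathbb{K}\in\{\mathbb{R},\mathbb{C}\}$, let $\Lambda$ be a $\sigma$-compact topological space and let $\mathfrak{B}\subset\mathbb{K}^\Lambda$ be an admissible Banach space. Then for every frame $\Phi=(\varphi_\lambda)_{\lambda\in\Lambda}\subset\mathcal{B}'$ of $\mathcal{B}$ with associated admissible Banach space $\mathfrak{B}$ and upper frame bound $B_{\Phi,\mathcal{B},\mathfrak{B}}<\infty$ it holds that $\sigma_{\Phi,\mathcal{B},\mathfrak{B}}=0$. Consequently, $$\inf_{\Phi}\ \tau_{\Phi,\mathcal{B},\mathfrak{B}}=\infty,$$ where the infimum is taken over all frames $\Phi\subset\mathcal{B}'$ of $\mathcal{B}$ with associated space $\mathfrak{B}$ and $B_{\Phi,\mathcal{B},\mathfrak{B}}<\infty$.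
   Context: Notation. $\mathcal{B}'$ is the topological dual of $\mathcal{B}$ with its norm, and $[x,\psi]:=\psi(x)$ for $x\in\mathcal{B},\psi\in\mathcal{B}'$. For a family $\Phi=(\varphi_\lambda)_{\lambda\in\Lambda}\subset\mathcal{B}'$ put $[x,\Phi]:=([x,\varphi_\lambda])_{\lambda\in\Lambda}$ and $|[x,\Phi]|:=(|[x,\varphi_\lambda]|)_{\lambda\in\Lambda}$. For $S\subset\Lambda$, $\chi_S$ is the indicator function of $S$, $\Phi_S:=(\varphi_\lambda)_{\lambda\in S}$, and $[x,\Phi_S]$ is regarded as an element of $\mathbb{K}^\Lambda$ by extension by zero, i.e. as $[x,\Phi]\chi_S$. Absolute values and products in $\mathbb{K}^\Lambda$ are pointwise. $\mathbb{P}_{\mathbb{K}}\mathcal{B}$ is the quotient of $\mathcal{B}$ identifying $x$ with $\tau x$ for all $\tau\in\mathbb{K}$, $|\tau|=1$, with the distance $d_{\mathcal{B}}(x,y)=\min\{\|x-\tau y\|_{\mathcal{B}}:\tau\in\mathbb{K},|\tau|=1\}$. The map $\mathcal{A}_\Phi$ on $\mathbb{P}_{\mathbb{K}}\mathcal{B}$ is $\mathcal{A}_\Phi(x)=|[x,\Phi]|$. Admissible Banach space. Let $\Lambda$ be a $\sigma$-compact topological space. A Banach space $\mathfrak{B}\subset\mathbb{K}^\Lambda$ over $\mathbb{K}$ is admissible if (with the convention $\|w\|_{\mathfrak{B}}=\infty$ for $w\in\mathbb{K}^\Lambda\setminus\mathfrak{B}$): (i) $\|\chi_{\Lambda'}\|_{\mathfrak{B}}<\infty$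 for every compact $\Lambda'\subset\Lambda$; (ii) $\mathfrak{B}$ is solid: $\|w\|_{\mathfrak{B}}=\||w|\|_{\mathfrak{B}}\le\|z\|_{\mathfrak{B}}$ for all $z\in\mathfrak{B}$ and $w$ with $|z(\lambda)|\ge|w(\lambda)|$ for all $\lambda\in\Lambda$; (iii) the elements of $\mathfrak{B}$ with compact support are dense in $\mathfrak{B}$. Frame. A family $\Phi=(\varphi_\lambda)_{\lambda\in\Lambda}\subset\mathcal{B}'$ with $\lambda\mapsto\varphi_\lambda$ continuous is a frame for $\mathcal{B}$ with associated admissible Banach space $\mathfrak{B}\subset\mathbb{K}^\Lambda$ if (B1) there are real constants $B\ge A>0$ with $A\|x\|_{\mathcal{B}}\le\|[x,\Phi]\|_{\mathfrak{B}}\le B\|x\|_{\mathcal{B}}$ for all $x\in\mathcal{B}$; and (B2) there is a continuous operator $R:\mathfrak{B}\to\mathcal{B}$ with $R([x,\Phi])=x$ for all $x\in\mathcal{B}$. The best possible constants are denoted $A_{\Phi,\mathcal{B},\mathfrak{B}}$ and $B_{\Phi,\mathcal{B},\mathfrak{B}}$. For $S\subset\Lambda$, $A_{\Phi_S,\mathcal{B},\mathfrak{B}}\ge 0$ is the largest $A\ge0$ with $A\|x\|_{\mathcal{B}}\le\|[x,\Phi_S]\|_{\mathfrak{B}}$ for all $x\in\mathcal{B}$. Strong complement property. $\Phi$ satisfies the $\sigma$-strong complement property ($\sigma>0$) if for every $S\subset\Lambda$, $\max\{A_{\Phi_S,\mathcal{B},\mathfrak{B}},A_{\Phi_{\Lambda\setminus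 S},\mathcal{B},\mathfrak{B}}\}\ge\sigma$. $\sigma_{\Phi,\mathcal{B},\mathfrak{B}}$ is the supremum of such $\sigma$ (equal to $0$ if there is none). Condition number. $\alpha_{\Phi,\mathcal{B},\mathfrak{B}}$ is the largest $\alpha\ge0$ and $\beta_{\Phi,\mathcal{B},\mathfrak{B}}$ the smallest $\beta$ such that $\alpha\, d_{\mathcal{B}}(x,y)\le\|\mathcal{A}_\Phi(x)-\mathcal{A}_\Phi(y)\|_{\mathfrak{B}}\le\beta\, d_{\mathcal{B}}(x,y)$ for all $x,y\in\mathcal{B}$; $\tau_{\Phi,\mathcal{B},\mathfrak{B}}:=\beta_{\Phi,\mathcal{B},\mathfrak{B}}/\alpha_{\Phi,\mathcal{B},\mathfrak{B}}$, understood as $\infty$ if $\alpha_{\Phi,\mathcal{B},\mathfrak{B}}=0$. *)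

theory Defs
  imports "HOL-Analysis.Analysis" "HOL-Library.Function_Algebras"
begin

section \<open>The scalar field\<close>

text \<open>
  The fields \<open>\<real>\<close> and \<open>\<complex>\<close> with their absolute values, up to isometric isomorphism.
\<close>

class real_or_complex = real_normed_field +
  assumes real_or_complex:
    "(\<exists>f :: 'a \<Rightarrow> real. bij f \<and> (\<forall>x y. f (x + y) = f x + f y) \<and> (\<forall>x y. f (x * y) = f x * f y) \<and>
        (\<forall>r x. f (r *\<^sub>R x) = r *\<^sub>R f x) \<and> (\<forall>x. norm (f x) = norm x)) \<or>
     (\<exists>f :: 'a \<Rightarrow> complex. bij f \<and> (\<forall>x y. f (x + y) = f x + f y) \<and> (\<forall>x y. f (x * y) = f x * f y) \<and>
        (\<forall>r x. f (r *\<^sub>R x) = r *\<^sub>R f x) \<and> (\<forall>x. norm (f x) = norm x))"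

instance real :: real_or_complex
  by standard (rule disjI1, rule exI[of _ id], simp)

instance complex :: real_or_complex
  by standard (rule disjI2, rule exI[of _ id], simp)


section \<open>Banach spaces over the scalar field\<close>

text \<open>
  The library's normed spaces are real. A normed space over the field \<open>'k\<close> is a real normed space
  with a scalar multiplication by \<open>'k\<close> that extends the real one and for which the norm is
  homogeneous.
\<close>

locale normed_space_over = vector_space smul
  for smul :: "'k::real_or_complex \<Rightarrow> 'b::real_normed_vector \<Rightarrow> 'b" +
  assumes scale_of_real: "smul (of_real r) x = r *\<^sub>R x"
    and norm_scale: "norm (smul c x) = norm c * norm x"

locale banach_space_over = normed_space_over smul
  for smul :: "'k::real_or_complex \<Rightarrow> 'b::banach \<Rightarrow> 'b"

definition infinite_dimensional :: "('k::field \<Rightarrow> 'b::ab_group_add \<Rightarrow> 'b) \<Rightarrow> bool" where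
  "infinite_dimensional smul \<longleftrightarrow> \<not> (\<exists>S. finite S \<and> module.span smul S = UNIV)"

text \<open>
  Bounded real-linear maps that are moreover linear over \<open>'k\<close>; norm and topology are those of the
  type of bounded linear maps, that is, the operator norm.
\<close>

definition dual :: "('k::real_or_complex \<Rightarrow> 'b::banach \<Rightarrow> 'b) \<Rightarrow> ('b \<Rightarrow>\<^sub>L 'k) set" where
  "dual smul = {\<psi>. \<forall>c x. blinfun_apply \<psi> (smul c x) = c * blinfun_apply \<psi> x}"

text \<open>
  Every continuous linear functional on the dual is the evaluation at a point;
  \<open>blinfun_mult_right c o\<^sub>L \<psi>\<close> is the functional \<open>c \<psi>\<close>.
\<close>

definition reflexive :: "('k::real_or_complex \<Rightarrow> 'b::banach \<Rightarrow> 'b) \<Rightarrow> bool" where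
  "reflexive smul \<longleftrightarrow>
    (\<forall>F :: ('b \<Rightarrow>\<^sub>L 'k) \<Rightarrow> 'k.
       (\<forall>\<psi>\<in>dual smul. \<forall>\<theta>\<in>dual smul. F (\<psi> + \<theta>) = F \<psi> + F \<theta>) \<and>
       (\<forall>c. \<forall>\<psi>\<in>dual smul. F (blinfun_mult_right c o\<^sub>L \<psi>) = c * F \<psi>) \<and>
       continuous_on (dual smul) F
       \<longrightarrow> (\<exists>x. \<forall>\<psi>\<in>dual smul. F \<psi> = blinfun_apply \<psi> x))"

text \<open>The distance on \<open>\<bbbP>\<^sub>\<bbbK>\<B>\<close>, on representatives; the infimum is a minimum.\<close>

definition phase_dist :: "('k::real_or_complex \<Rightarrow> 'b::banach \<Rightarrow> 'b) \<Rightarrow> 'b \<Rightarrow> 'b \<Rightarrow> real" where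
  "phase_dist smul x y = (INF \<tau>\<in>{\<tau>. norm \<tau> = 1}. norm (x - smul \<tau> y))"


section \<open>Admissible Banach spaces of functions\<close>

definition sigma_compact :: "'l::topological_space set \<Rightarrow> bool" where
  "sigma_compact S \<longleftrightarrow> (\<exists>K :: nat \<Rightarrow> 'l set. (\<forall>n. compact (K n)) \<and> (\<Union>n. K n) = S)"

definition compactly_supported :: "('l::topological_space \<Rightarrow> 'k::zero) \<Rightarrow> bool" where
  "compactly_supported w \<longleftrightarrow> compact (closure {l. w l \<noteq> 0})"

text \<open>
  A Banach space of functions is given by its set \<open>W\<close> of elements and its norm \<open>N\<close>, whose values
  outside \<open>W\<close> are irrelevant.
\<close>

definition fun_dist :: "('l \<Rightarrow> 'k::real_or_complex) set \<Rightarrow> (('l \<Rightarrow> 'k) \<Rightarrow> real) \<Rightarrow>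
    ('l \<Rightarrow> 'k) \<Rightarrow> ('l \<Rightarrow> 'k) \<Rightarrow> real" where
  "fun_dist W N w z = (if w \<in> W \<and> z \<in> W then N (w - z) else 0)"

definition ext_norm :: "('l \<Rightarrow> 'k::real_or_complex) set \<Rightarrow> (('l \<Rightarrow> 'k) \<Rightarrow> real) \<Rightarrow>
    ('l \<Rightarrow> 'k) \<Rightarrow> ereal" where
  "ext_norm W N w = (if w \<in> W then ereal (N w) else \<infinity>)"

definition abs_fun :: "('l \<Rightarrow> 'k::real_or_complex) \<Rightarrow> 'l \<Rightarrow> 'k" where
  "abs_fun w = (\<lambda>l. of_real (norm (w l)))"

locale banach_function_space =
  fixes W :: "('l \<Rightarrow> 'k::real_or_complex) set"
    and N :: "('l \<Rightarrow> 'k) \<Rightarrow> real"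
  assumes subspace_W: "module.subspace (\<lambda>c w l. c * w l) W"
    and norm_eq_0: "w \<in> W \<Longrightarrow> N w = 0 \<longleftrightarrow> w = 0"
    and norm_triangle: "w \<in> W \<Longrightarrow> z \<in> W \<Longrightarrow> N (w + z) \<le> N w + N z"
    and norm_homogeneous: "w \<in> W \<Longrightarrow> N (\<lambda>l. c * w l) = norm c * N w"
    and complete_W: "Metric_space.mcomplete W (fun_dist W N)"

locale admissible_banach_space = banach_function_space W N
  for W :: "('l::topological_space \<Rightarrow> 'k::real_or_complex) set"
    and N :: "('l \<Rightarrow> 'k) \<Rightarrow> real" +
  assumes indicator_compact: "compact C \<Longrightarrow> ext_norm W N (indicator C) < \<infinity>"
    and solid: "z \<in> W \<Longrightarrow> (\<forall>l. norm (w l) \<le> norm (z l)) \<Longrightarrow>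
      ext_norm W N w = ext_norm W N (abs_fun w) \<and> ext_norm W N (abs_fun w) \<le> ext_norm W N z"
    and dense_compact_support: "Metric_space.mtopology W (fun_dist W N) closure_of
      {w \<in> W. compactly_supported w} = W"


section \<open>Frames\<close>

definition coeffs :: "('l \<Rightarrow> ('b::banach \<Rightarrow>\<^sub>L 'k::real_or_complex)) \<Rightarrow> 'b \<Rightarrow> 'l \<Rightarrow> 'k" where
  "coeffs \<Phi> x = (\<lambda>l. blinfun_apply (\<Phi> l) x)"

definition restricted_coeffs :: "('l \<Rightarrow> ('b::banach \<Rightarrow>\<^sub>L 'k::real_or_complex)) \<Rightarrow> 'l set \<Rightarrow>
    'b \<Rightarrow> 'l \<Rightarrow> 'k" where
  "restricted_coeffs \<Phi> S x = (\<lambda>l. coeffs \<Phi> x l * indicator S l)"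

definition frame :: "('k::real_or_complex \<Rightarrow> 'b::banach \<Rightarrow> 'b) \<Rightarrow>
    ('l::topological_space \<Rightarrow> 'k) set \<Rightarrow> (('l \<Rightarrow> 'k) \<Rightarrow> real) \<Rightarrow> ('l \<Rightarrow> ('b \<Rightarrow>\<^sub>L 'k)) \<Rightarrow> bool" where
  "frame smul W N \<Phi> \<longleftrightarrow>
     (\<forall>l. \<Phi> l \<in> dual smul) \<and> continuous_on UNIV \<Phi> \<and>
     (\<exists>A B :: real. 0 < A \<and> A \<le> B \<and>
        (\<forall>x. ereal (A * norm x) \<le> ext_norm W N (coeffs \<Phi> x) \<and>
             ext_norm W N (coeffs \<Phi> x) \<le> ereal (B * norm x))) \<and>
     (\<exists>R :: ('l \<Rightarrow> 'k) \<Rightarrow> 'b.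
        (\<forall>w\<in>W. \<forall>z\<in>W. R (w + z) = R w + R z) \<and>
        (\<forall>c. \<forall>w\<in>W. R (\<lambda>l. c * w l) = smul c (R w)) \<and>
        continuous_map (Metric_space.mtopology W (fun_dist W N)) euclidean R \<and>
        (\<forall>x. R (coeffs \<Phi> x) = x))"

definition upper_frame_bound :: "('l \<Rightarrow> 'k::real_or_complex) set \<Rightarrow> (('l \<Rightarrow> 'k) \<Rightarrow> real) \<Rightarrow>
    ('l \<Rightarrow> ('b::banach \<Rightarrow>\<^sub>L 'k)) \<Rightarrow> ereal" where
  "upper_frame_bound W N \<Phi> =
     Inf {ereal B | B. \<forall>x. ext_norm W N (coeffs \<Phi> x) \<le> ereal (B * norm x)}"

text \<open>
  Best constants are suprema and infima in the extended reals; they are attained as soon as they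
  are finite.
\<close>

definition lower_bound_on :: "('l \<Rightarrow> 'k::real_or_complex) set \<Rightarrow> (('l \<Rightarrow> 'k) \<Rightarrow> real) \<Rightarrow>
    ('l \<Rightarrow> ('b::banach \<Rightarrow>\<^sub>L 'k)) \<Rightarrow> 'l set \<Rightarrow> ereal" where
  "lower_bound_on W N \<Phi> S =
     Sup {ereal A | A. 0 \<le> A \<and> (\<forall>x. ereal (A * norm x) \<le> ext_norm W N (restricted_coeffs \<Phi> S x))}"

definition strong_complement_property :: "('l \<Rightarrow> 'k::real_or_complex) set \<Rightarrow>
    (('l \<Rightarrow> 'k) \<Rightarrow> real) \<Rightarrow> ('l \<Rightarrow> ('b::banach \<Rightarrow>\<^sub>L 'k)) \<Rightarrow> real \<Rightarrow> bool" where
  "strong_complement_property W N \<Phi> \<sigma> \<longleftrightarrow> 0 < \<sigma> \<and>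
     (\<forall>S. ereal \<sigma> \<le> max (lower_bound_on W N \<Phi> S) (lower_bound_on W N \<Phi> (- S)))"

text \<open>Inserting \<open>0\<close> makes the supremum \<open>0\<close> when the property holds for no \<open>\<sigma>\<close>.\<close>

definition scp_constant :: "('l \<Rightarrow> 'k::real_or_complex) set \<Rightarrow> (('l \<Rightarrow> 'k) \<Rightarrow> real) \<Rightarrow>
    ('l \<Rightarrow> ('b::banach \<Rightarrow>\<^sub>L 'k)) \<Rightarrow> ereal" where
  "scp_constant W N \<Phi> = Sup (insert 0 {ereal \<sigma> | \<sigma>. strong_complement_property W N \<Phi> \<sigma>})"


section \<open>Condition number of phase retrieval\<close>

definition measurement :: "('l \<Rightarrow> ('b::banach \<Rightarrow>\<^sub>L 'k::real_or_complex)) \<Rightarrow> 'b \<Rightarrow> 'l \<Rightarrow> 'k" where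
  "measurement \<Phi> x = abs_fun (coeffs \<Phi> x)"

definition lower_lipschitz :: "('k::real_or_complex \<Rightarrow> 'b::banach \<Rightarrow> 'b) \<Rightarrow> ('l \<Rightarrow> 'k) set \<Rightarrow>
    (('l \<Rightarrow> 'k) \<Rightarrow> real) \<Rightarrow> ('l \<Rightarrow> ('b \<Rightarrow>\<^sub>L 'k)) \<Rightarrow> ereal" where
  "lower_lipschitz smul W N \<Phi> = Sup {ereal \<alpha> | \<alpha>. 0 \<le> \<alpha> \<and>
     (\<forall>x y. ereal (\<alpha> * phase_dist smul x y) \<le> ext_norm W N (measurement \<Phi> x - measurement \<Phi> y))}"

definition upper_lipschitz :: "('k::real_or_complex \<Rightarrow> 'b::banach \<Rightarrow> 'b) \<Rightarrow> ('l \<Rightarrow> 'k) set \<Rightarrow>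
    (('l \<Rightarrow> 'k) \<Rightarrow> real) \<Rightarrow> ('l \<Rightarrow> ('b \<Rightarrow>\<^sub>L 'k)) \<Rightarrow> ereal" where
  "upper_lipschitz smul W N \<Phi> = Inf {ereal \<beta> | \<beta>.
     \<forall>x y. ext_norm W N (measurement \<Phi> x - measurement \<Phi> y) \<le> ereal (\<beta> * phase_dist smul x y)}"

definition condition_number :: "('k::real_or_complex \<Rightarrow> 'b::banach \<Rightarrow> 'b) \<Rightarrow> ('l \<Rightarrow> 'k) set \<Rightarrow>
    (('l \<Rightarrow> 'k) \<Rightarrow> real) \<Rightarrow> ('l \<Rightarrow> ('b \<Rightarrow>\<^sub>L 'k)) \<Rightarrow> ereal" where
  "condition_number smul W N \<Phi> =
     (if lower_lipschitz smul W N \<Phi> = 0 then \<infinity>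
      else upper_lipschitz smul W N \<Phi> / lower_lipschitz smul W N \<Phi>)"

end

theory Submission
  imports Defs
begin

text \<open>
  The strong complement property fails at every level because a frame over an
  infinite-dimensional space looks essentially finite-dimensional on each compact \<open>C \<subseteq> \<Lambda>\<close>,
  while every coefficient family essentially lives on a compact set.

  On the one hand, \<open>\<lambda> \<mapsto> \<phi>\<^sub>\<lambda>\<close> is norm continuous, so the \<open>\<phi>\<^sub>\<lambda>\<close> with \<open>\<lambda> \<in> C\<close> lie within
  \<open>\<delta>\<close> of finitely many functionals. These have a common zero \<open>u\<close> of norm \<open>1\<close>, as the space has
  infinite dimension, and so \<open>\<bar>\<phi>\<^sub>\<lambda>(u)\<bar> \<le> \<delta>\<close> on all of \<open>C\<close>; solidity makes the norm of
  \<open>[u, \<Phi>\<^sub>C]\<close> at most \<open>\<delta>\<close> times that of \<open>\<chi>\<^sub>C\<close> (\<open>small_on_compact\<close>). On the other hand, for any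
  fixed unit vector \<open>v\<close>, density of the compactly supported elements provides a compact \<open>C\<close> such
  that the restriction of \<open>[v, \<Phi>]\<close> to \<open>-C\<close> has small norm (\<open>small_off_compact\<close>). Choosing first \<open>v\<close>, then
  \<open>C\<close>, then \<open>u\<close> shows that both lower bounds, for \<open>C\<close> and for \<open>-C\<close>, are as small as desired.

  The same pair \<open>u\<close>, \<open>v\<close> destroys stability of phase retrieval. The signals \<open>u + v\<close> and \<open>u - v\<close>
  have almost the same measurements, since \<open>\<bar>\<bar>a + b\<bar> - \<bar>a - b\<bar>\<bar> \<le> 2 min(\<bar>a\<bar>, \<bar>b\<bar>)\<close> and at each
  \<open>\<lambda>\<close> one of the two coefficients is negligible (\<open>measurement_diff_le\<close>). Yet
  \<open>u + v - \<tau>(u - v) = (1 - \<tau>)u + (1 + \<tau>)v\<close> stays away from \<open>0\<close> uniformly in the phase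
  \<open>\<tau>\<close>: the coefficients of \<open>u\<close> are concentrated off \<open>C\<close> and those of \<open>v\<close> on \<open>C\<close>, so they
  cannot cancel, and one of \<open>\<bar>1 - \<tau>\<bar>\<close>, \<open>\<bar>1 + \<tau>\<bar>\<close> is at least \<open>1\<close> (\<open>phase_dist_ge\<close>). Hence the
  lower Lipschitz constant is \<open>0\<close> for every frame.
\<close>

section \<open>Common zeros of finitely many functionals\<close>

text \<open>
  A common kernel of finitely many functionals has a finite-dimensional complement: a functional
  that does not vanish on the kernel \<open>Z\<close> of the others is nonzero at some \<open>e \<in> Z\<close>, and
  adding \<open>e\<close> to the complement allows to correct its value.
\<close>

lemma (in normed_space_over) finite_codimension_common_kernel:
  fixes F :: "('b \<Rightarrow> 'k) set"
  assumes "finite F"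
    and "\<And>f x y. f \<in> F \<Longrightarrow> f (x + y) = f x + f y"
    and "\<And>f c x. f \<in> F \<Longrightarrow> f (smul c x) = c * f x"
  shows "\<exists>S. finite S \<and> (\<forall>x. \<exists>s\<in>span S. \<forall>f\<in>F. f (x - s) = 0)"
  using assms
proof (induction F rule: finite_induct)
  case empty
  then show ?case by (auto intro: span_zero)
next
  case (insert g F)
  then obtain S where S: "finite S" "\<And>x. \<exists>s\<in>span S. \<forall>f\<in>F. f (x - s) = 0"
    by auto
  have diff: "f (x - y) = f x - f y" if "f \<in> insert g F" for f x y
    using insert.prems(1)[OF that, of "x - y" y] by simp
  show ?case
  proof (cases "\<forall>x. (\<forall>f\<in>F. f x = 0) \<longrightarrow> g x = 0")
    case True
    then show ?thesis using S by (metis insert_iff)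
  next
    case False
    then obtain e where e: "\<And>f. f \<in> F \<Longrightarrow> f e = 0" "g e \<noteq> 0" by auto
    have "\<exists>s'\<in>span (insert e S). \<forall>f\<in>insert g F. f (x - s') = 0" for x
    proof -
      obtain s where s: "s \<in> span S" "\<And>f. f \<in> F \<Longrightarrow> f (x - s) = 0" using S(2) by blast
      let ?s' = "s + smul (g (x - s) / g e) e"
      have "s \<in> span (insert e S)" using s(1) span_mono[of S "insert e S"] by blast
      then have "?s' \<in> span (insert e S)"
        by (intro span_add span_scale) (auto intro: span_base)
      moreover have "f (x - ?s') = 0" if "f \<in> insert g F" for f
      proof -
        have "f (x - ?s') = f (x - s) - g (x - s) / g e * f e"
          using diff[OF that] insert.prems[OF that] by simp
        then show ?thesis using that e(1)[of f] e(2) s(2)[of f] by auto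
      qed
      ultimately show ?thesis by blast
    qed
    then show ?thesis using S(1) by (meson finite_insert)
  qed
qed

lemma (in banach_space_over) unit_common_zero:
  assumes "infinite_dimensional smul" and "finite F" and "F \<subseteq> dual smul"
  shows "\<exists>u. norm u = 1 \<and> (\<forall>\<psi>\<in>F. blinfun_apply \<psi> u = 0)"
proof -
  have "\<exists>S. finite S \<and> (\<forall>x. \<exists>s\<in>span S. \<forall>f\<in>blinfun_apply ` F. f (x - s) = 0)"
    by (rule finite_codimension_common_kernel)
      (use assms(2,3) in \<open>auto simp: dual_def blinfun.add_right\<close>)
  then obtain S where S: "finite S"
    "\<And>x. \<exists>s\<in>span S. \<forall>f\<in>blinfun_apply ` F. f (x - s) = 0"
    by blast
  have "span S \<noteq> UNIV" using assms(1) S(1) by (auto simp: infinite_dimensional_def)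
  then obtain x where "x \<notin> span S" by auto
  moreover obtain s where s: "s \<in> span S" "\<And>\<psi>. \<psi> \<in> F \<Longrightarrow> blinfun_apply \<psi> (x - s) = 0"
    using S(2)[of x] by auto
  ultimately have "x - s \<noteq> 0" by auto
  with s(2) show ?thesis
    by (intro exI[of _ "sgn (x - s)"]) (simp add: norm_sgn sgn_div_norm blinfun.scaleR_right)
qed

section \<open>Norm calculus in solid function spaces\<close>

context banach_function_space
begin

lemma module_pointwise: "module (\<lambda>c (w :: 'l \<Rightarrow> 'k) l. c * w l)"
  by standard (auto simp: fun_eq_iff algebra_simps)

lemma add_in_W: "w \<in> W \<Longrightarrow> z \<in> W \<Longrightarrow> w + z \<in> W"
  using subspace_W module.subspace_add[OF module_pointwise] by blast

lemma scale_in_W: "w \<in> W \<Longrightarrow> (\<lambda>l. c * w l) \<in> W"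
  using subspace_W module.subspace_scale[OF module_pointwise] by blast

lemma diff_in_W: "w \<in> W \<Longrightarrow> z \<in> W \<Longrightarrow> w - z \<in> W"
  using subspace_W module.subspace_diff[OF module_pointwise] by blast

lemma N_minus_commute: "w \<in> W \<Longrightarrow> z \<in> W \<Longrightarrow> N (w - z) = N (z - w)"
  using norm_homogeneous[OF diff_in_W, of z w "-1"] by (simp add: fun_diff_def)

lemma N_nonneg:
  assumes "w \<in> W"
  shows "0 \<le> N w"
proof -
  have "w + (\<lambda>l. - 1 * w l) = 0" by (simp add: fun_eq_iff)
  then have "N 0 \<le> N w + N (\<lambda>l. - 1 * w l)"
    using norm_triangle[OF assms scale_in_W[OF assms, of "-1"]] by metis
  moreover have "N 0 = 0" using norm_eq_0[OF diff_in_W[OF assms assms]] by simp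
  ultimately show ?thesis using norm_homogeneous[OF assms, of "-1"] by simp
qed

lemma Metric_space_fun_dist: "Metric_space W (fun_dist W N)"
proof
  fix x y z
  show "0 \<le> fun_dist W N x y" by (simp add: fun_dist_def N_nonneg diff_in_W)
  show "fun_dist W N x y = fun_dist W N y x" by (simp add: fun_dist_def N_minus_commute)
  assume *: "x \<in> W" "y \<in> W"
  then show "(fun_dist W N x y = 0) = (x = y)"
    using norm_eq_0[OF diff_in_W, of x y] by (simp add: fun_dist_def)
  assume "z \<in> W"
  with * show "fun_dist W N x z \<le> fun_dist W N x y + fun_dist W N y z"
    using norm_triangle[OF diff_in_W diff_in_W, of x y y z] by (simp add: fun_dist_def)
qed

end

context admissible_banach_space
begin

lemma dominated:
  assumes "z \<in> W" and "\<And>l. norm (w l) \<le> norm (z l)"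
  shows "w \<in> W" and "N w \<le> N z"
  using solid[of z w] assms by (auto simp: ext_norm_def split: if_splits)

lemma restriction:
  assumes "w \<in> W"
  shows "(\<lambda>l. w l * indicator S l) \<in> W" and "N (\<lambda>l. w l * indicator S l) \<le> N w"
  by (rule dominated[OF assms]; simp add: indicator_def)+

lemma N_le_restrictions:
  assumes "w \<in> W"
  shows "N w \<le> N (\<lambda>l. w l * indicator S l) + N (\<lambda>l. w l * indicator (- S) l)"
proof -
  have "w = (\<lambda>l. w l * indicator S l) + (\<lambda>l. w l * indicator (- S) l)"
    by (auto simp: fun_eq_iff indicator_def)
  then show ?thesis
    using norm_triangle[OF restriction(1) restriction(1), OF assms assms, of S "- S"] by metis
qed

text \<open>
  The restriction of \<open>w\<close> to the complement of the support of an approximant \<open>z\<close> is dominated by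
  \<open>w - z\<close>.
\<close>

lemma small_off_compact:
  assumes "w \<in> W" and "0 < \<epsilon>"
  shows "\<exists>C. compact C \<and> N (\<lambda>l. w l * indicator (- C) l) \<le> \<epsilon>"
proof -
  interpret M: Metric_space W "fun_dist W N" by (rule Metric_space_fun_dist)
  obtain z where z: "z \<in> W" "compactly_supported z" "fun_dist W N w z < \<epsilon>"
    using assms dense_compact_support unfolding M.metric_closure_of by (force simp: M.in_mball)
  let ?C = "closure {l. z l \<noteq> 0}"
  have "norm (w l * indicator (- ?C) l) \<le> norm ((w - z) l)" for l
  proof (cases "l \<in> ?C")
    case False
    then have "z l = 0" using closure_subset[of "{l. z l \<noteq> 0}"] by blast
    then show ?thesis using False by simp
  qed simp
  then have "N (\<lambda>l. w l * indicator (- ?C) l) \<le> N (w - z)"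
    by (rule dominated(2)[OF diff_in_W[OF assms(1) z(1)]])
  also have "\<dots> \<le> \<epsilon>" using z(1,3) assms(1) by (simp add: fun_dist_def)
  finally show ?thesis using z(2) unfolding compactly_supported_def by blast
qed

end

section \<open>Localized unit vectors of a frame\<close>

locale framed_banach_space = banach_space_over smul + admissible_banach_space W N
  for smul :: "'k::real_or_complex \<Rightarrow> 'b::banach \<Rightarrow> 'b"
    and W :: "('l::topological_space \<Rightarrow> 'k) set"
    and N :: "('l \<Rightarrow> 'k) \<Rightarrow> real" +
  fixes \<Phi> :: "'l \<Rightarrow> ('b \<Rightarrow>\<^sub>L 'k)"
  assumes frame: "frame smul W N \<Phi>"
begin

lemma frame_bounds:
  obtains A B where "0 < A" "0 < B" "\<And>x. A * norm x \<le> N (coeffs \<Phi> x)"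
    "\<And>x. N (coeffs \<Phi> x) \<le> B * norm x" "\<And>x. coeffs \<Phi> x \<in> W"
proof -
  obtain A B where AB: "0 < A" "A \<le> B"
    "\<And>x. ereal (A * norm x) \<le> ext_norm W N (coeffs \<Phi> x)"
    "\<And>x. ext_norm W N (coeffs \<Phi> x) \<le> ereal (B * norm x)"
    using frame unfolding frame_def by blast
  have W: "coeffs \<Phi> x \<in> W" for x
    using AB(4)[of x] by (auto simp: ext_norm_def split: if_splits)
  show thesis
    using that[of A B] AB W by (auto simp: ext_norm_def)
qed

lemma coeffs_in_W: "coeffs \<Phi> x \<in> W"
  using frame_bounds by metis

lemma restricted_in_W: "restricted_coeffs \<Phi> S x \<in> W"
  unfolding restricted_coeffs_def by (rule restriction) (rule coeffs_in_W)

lemma coeffs_combination: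
  "coeffs \<Phi> (smul c x + smul d y) l = c * coeffs \<Phi> x l + d * coeffs \<Phi> y l"
  using frame by (simp add: coeffs_def frame_def dual_def blinfun.add_right)

text \<open>
  The unit vector annihilates a finite \<open>\<delta>\<close>-net of the compact set of functionals with index in
  \<open>C\<close>.
\<close>

lemma small_on_compact:
  assumes inf: "infinite_dimensional smul" and C: "compact C" and "0 < \<epsilon>"
  shows "\<exists>u. norm u = 1 \<and> N (restricted_coeffs \<Phi> C u) \<le> \<epsilon>"
proof -
  have ind: "indicator C \<in> W"
    using indicator_compact[OF C] by (auto simp: ext_norm_def split: if_splits)
  define \<delta> where "\<delta> = \<epsilon> / (N (indicator C) + 1)"
  have pos: "0 < N (indicator C) + 1" using N_nonneg[OF ind] by linarith
  then have \<delta>: "0 < \<delta>" using \<open>0 < \<epsilon>\<close> by (simp add: \<delta>_def)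
  have "compact (\<Phi> ` C)"
    using frame C by (auto simp: frame_def intro: compact_continuous_image continuous_on_subset)
  then obtain F where F: "finite F" "F \<subseteq> \<Phi> ` C" "\<Phi> ` C \<subseteq> (\<Union>\<psi>\<in>F. ball \<psi> \<delta>)"
    using seq_compact_imp_totally_bounded[OF compact_imp_seq_compact, of "\<Phi> ` C"] \<delta> by blast
  have "F \<subseteq> dual smul" using F(2) frame by (auto simp: frame_def)
  then obtain u where u: "norm u = 1" "\<And>\<psi>. \<psi> \<in> F \<Longrightarrow> blinfun_apply \<psi> u = 0"
    using unit_common_zero[OF inf F(1)] by blast
  have small: "norm (restricted_coeffs \<Phi> C u l) \<le> norm (of_real \<delta> * indicator C l :: 'k)" for l
  proof (cases "l \<in> C")
    case True
    then obtain \<psi> where \<psi>: "\<psi> \<in> F" "dist \<psi> (\<Phi> l) < \<delta>" using F(3) by fastforce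
    have "coeffs \<Phi> u l = blinfun_apply (\<Phi> l - \<psi>) u"
      using u(2)[OF \<psi>(1)] by (simp add: coeffs_def blinfun.diff_left)
    also have "norm \<dots> \<le> norm (\<Phi> l - \<psi>)" using norm_blinfun[of "\<Phi> l - \<psi>" u] u(1) by simp
    also have "\<dots> \<le> \<delta>" using \<psi>(2) by (simp add: dist_norm norm_minus_commute)
    finally show ?thesis using True \<delta> by (simp add: restricted_coeffs_def)
  qed (simp add: restricted_coeffs_def)
  have "N (restricted_coeffs \<Phi> C u) \<le> N (\<lambda>l. of_real \<delta> * indicator C l)"
    by (rule dominated(2)[OF scale_in_W[OF ind] small])
  also have "\<dots> = \<delta> * N (indicator C)" using norm_homogeneous[OF ind] \<delta> by simp
  also have "\<dots> \<le> \<epsilon>" using \<open>0 < \<epsilon>\<close> pos by (simp add: \<delta>_def field_simps)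
  finally show ?thesis using u(1) by blast
qed

lemma complementary_localized_unit_vectors:
  assumes "infinite_dimensional smul" and "0 < \<epsilon>"
  obtains C u v where "norm u = 1" "N (restricted_coeffs \<Phi> C u) \<le> \<epsilon>"
    "norm v = 1" "N (restricted_coeffs \<Phi> (- C) v) \<le> \<epsilon>"
proof -
  obtain v where v: "norm (v :: 'b) = 1" using unit_common_zero[OF assms(1), of "{}"] by auto
  obtain C where C: "compact C" "N (restricted_coeffs \<Phi> (- C) v) \<le> \<epsilon>"
    using small_off_compact[OF coeffs_in_W assms(2)] unfolding restricted_coeffs_def by blast
  with small_on_compact[OF assms(1) C(1) assms(2)] v that show thesis by blast
qed

section \<open>Failure of the strong complement property\<close>

lemma lower_bound_on_le:
  assumes "norm x = 1" and "N (restricted_coeffs \<Phi> S x) \<le> \<epsilon>"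
  shows "lower_bound_on W N \<Phi> S \<le> ereal \<epsilon>"
  unfolding lower_bound_on_def
proof (rule Sup_least, clarify)
  fix A assume "\<forall>x. ereal (A * norm x) \<le> ext_norm W N (restricted_coeffs \<Phi> S x)"
  then have "ereal (A * norm x) \<le> ext_norm W N (restricted_coeffs \<Phi> S x)" by blast
  then show "ereal A \<le> ereal \<epsilon>" using assms restricted_in_W by (simp add: ext_norm_def)
qed

lemma scp_constant_eq_0:
  assumes "infinite_dimensional smul"
  shows "scp_constant W N \<Phi> = 0"
proof -
  have "\<not> strong_complement_property W N \<Phi> \<sigma>" for \<sigma>
  proof
    assume scp: "strong_complement_property W N \<Phi> \<sigma>"
    then have "0 < \<sigma> / 2" by (simp add: strong_complement_property_def)
    then obtain C u v where "norm u = 1" "N (restricted_coeffs \<Phi> C u) \<le> \<sigma> / 2"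
      "norm v = 1" "N (restricted_coeffs \<Phi> (- C) v) \<le> \<sigma> / 2"
      by (rule complementary_localized_unit_vectors[OF assms])
    then have "max (lower_bound_on W N \<Phi> C) (lower_bound_on W N \<Phi> (- C)) \<le> ereal (\<sigma> / 2)"
      by (simp add: lower_bound_on_le)
    moreover have "ereal \<sigma> \<le> max (lower_bound_on W N \<Phi> C) (lower_bound_on W N \<Phi> (- C))"
      using scp by (simp add: strong_complement_property_def)
    ultimately have "ereal \<sigma> \<le> ereal (\<sigma> / 2)" by (rule order_trans[rotated])
    then show False using \<open>0 < \<sigma> / 2\<close> by simp
  qed
  then show ?thesis by (simp add: scp_constant_def)
qed

section \<open>Instability of phase retrieval\<close>

text \<open>
  Let \<open>a\<close>, \<open>b\<close> be the coefficients of \<open>u\<close>, \<open>v\<close> at an index. The difference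
  \<open>\<bar>a + b\<bar> - \<bar>a - b\<bar>\<close> is at most both \<open>2\<bar>a\<bar>\<close> and \<open>2\<bar>b\<bar>\<close>; the former is used on \<open>S\<close>, the
  latter off \<open>S\<close>.
\<close>

lemma measurement_diff_le:
  assumes "N (restricted_coeffs \<Phi> S u) \<le> \<epsilon>" and "N (restricted_coeffs \<Phi> (- S) v) \<le> \<epsilon>"
  shows "ext_norm W N (measurement \<Phi> (u + v) - measurement \<Phi> (u - v)) \<le> ereal (4 * \<epsilon>)"
proof -
  let ?u = "\<lambda>l. 2 * restricted_coeffs \<Phi> S u l"
  let ?v = "\<lambda>l. 2 * restricted_coeffs \<Phi> (- S) v l"
  let ?m = "measurement \<Phi> (u + v) - measurement \<Phi> (u - v)"
  have uv: "?u \<in> W" "?v \<in> W" by (intro scale_in_W restricted_in_W)+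
  have le: "norm (?m l) \<le> norm ((?u + ?v) l)" for l
  proof -
    let ?a = "blinfun_apply (\<Phi> l) u" and ?b = "blinfun_apply (\<Phi> l) v"
    have "?m l = of_real (norm (?a + ?b) - norm (?a - ?b))"
      by (simp add: measurement_def abs_fun_def coeffs_def blinfun.add_right blinfun.diff_right)
    then have m: "norm (?m l) = \<bar>norm (?a + ?b) - norm (?a - ?b)\<bar>" by (simp only: norm_of_real)
    have two: "norm (x + x) = 2 * norm x" for x :: 'k
      by (simp add: norm_mult flip: mult_2)
    have "\<bar>norm (?a + ?b) - norm (?a - ?b)\<bar> \<le> 2 * norm ?b"
      using norm_triangle_ineq3[of "?a + ?b" "?a - ?b"] two[of ?b] by simp
    moreover have "\<bar>norm (?a + ?b) - norm (?a - ?b)\<bar> \<le> 2 * norm ?a"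
      using norm_triangle_ineq3[of "?a + ?b" "?b - ?a"] two[of ?a] norm_minus_commute[of ?a ?b]
      by simp
    ultimately show ?thesis
      unfolding m by (auto simp: restricted_coeffs_def coeffs_def indicator_def norm_mult)
  qed
  have dom: "?m \<in> W" "N ?m \<le> N (?u + ?v)"
    by (rule dominated[OF add_in_W[OF uv] le])+
  have "N ?m \<le> N ?u + N ?v" using dom(2) norm_triangle[OF uv] by linarith
  also have "\<dots> \<le> 4 * \<epsilon>" using assms norm_homogeneous[OF restricted_in_W, of 2] by simp
  finally show ?thesis using dom(1) by (simp add: ext_norm_def)
qed

text \<open>
  On \<open>S\<close> the coefficients of \<open>c u + d v\<close> are essentially those of \<open>d v\<close>, and \<open>v\<close> keeps nearly
  its full norm when restricted to \<open>S\<close>.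
\<close>

lemma combination_ge:
  assumes "\<And>x. A * norm x \<le> N (coeffs \<Phi> x)" and "\<And>x. N (coeffs \<Phi> x) \<le> B * norm x"
    and "N (restricted_coeffs \<Phi> S u) \<le> \<epsilon>" and "N (restricted_coeffs \<Phi> (- S) v) \<le> \<epsilon>"
    and "norm v = 1" and "norm c \<le> 2" and "1 \<le> norm d"
  shows "A - 3 * \<epsilon> \<le> B * norm (smul c u + smul d v)"
proof -
  let ?z = "smul c u + smul d v"
  let ?r = "restricted_coeffs \<Phi> S"
  note W = restricted_in_W
  have nonneg: "0 \<le> N (?r u)" "0 \<le> N (?r v)" by (intro N_nonneg W)+
  have "A \<le> N (?r v) + \<epsilon>"
    using assms(1)[of v] assms(4,5) N_le_restrictions[OF coeffs_in_W, of v S]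
    by (simp add: restricted_coeffs_def)
  moreover have "N (?r v) \<le> norm d * N (?r v)"
    using assms(7) nonneg(2) mult_right_mono[of 1 "norm d" "N (?r v)"] by simp
  moreover have "norm d * N (?r v) = N (\<lambda>l. d * ?r v l)" by (simp add: norm_homogeneous W)
  moreover have "(\<lambda>l. d * ?r v l) = ?r ?z + (\<lambda>l. - c * ?r u l)"
    by (auto simp: fun_eq_iff restricted_coeffs_def coeffs_combination algebra_simps)
  then have "N (\<lambda>l. d * ?r v l) \<le> N (?r ?z) + N (\<lambda>l. - c * ?r u l)"
    using norm_triangle[OF W scale_in_W[OF W]] by metis
  moreover have "N (\<lambda>l. - c * ?r u l) = norm c * N (?r u)"
    using norm_homogeneous[OF W, of "- c"] by simp
  moreover have "norm c * N (?r u) \<le> 2 * \<epsilon>"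
    using assms(3,6) nonneg(1) by (intro mult_mono) auto
  moreover have "N (?r ?z) \<le> B * norm ?z"
    using restriction(2)[OF coeffs_in_W, of ?z S] assms(2)[of ?z]
    by (simp add: restricted_coeffs_def)
  ultimately show ?thesis by linarith
qed

lemma phase_dist_ge:
  assumes "\<And>x. A * norm x \<le> N (coeffs \<Phi> x)" and "\<And>x. N (coeffs \<Phi> x) \<le> B * norm x" and "0 < B"
    and "norm u = 1" and "N (restricted_coeffs \<Phi> S u) \<le> \<epsilon>"
    and "norm v = 1" and "N (restricted_coeffs \<Phi> (- S) v) \<le> \<epsilon>"
  shows "A - 3 * \<epsilon> \<le> B * phase_dist smul (u + v) (u - v)"
proof -
  have "(A - 3 * \<epsilon>) / B \<le> norm (u + v - smul \<tau> (u - v))" if \<tau>: "norm \<tau> = 1" for \<tau>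
  proof -
    have z: "u + v - smul \<tau> (u - v) = smul (1 - \<tau>) u + smul (1 + \<tau>) v"
      by (simp add: algebra_simps)
    have le2: "norm (1 - \<tau>) \<le> 2" "norm (1 + \<tau>) \<le> 2"
      using \<tau> norm_triangle_ineq4[of 1 \<tau>] norm_triangle_ineq[of 1 \<tau>] by auto
    have "(1 - \<tau>) + (1 + \<tau>) = 2" by simp
    then have "2 \<le> norm (1 - \<tau>) + norm (1 + \<tau>)"
      using norm_triangle_ineq[of "1 - \<tau>" "1 + \<tau>"] by (metis norm_numeral)
    then consider "1 \<le> norm (1 + \<tau>)" | "1 \<le> norm (1 - \<tau>)" by linarith
    then have "A - 3 * \<epsilon> \<le> B * norm (smul (1 - \<tau>) u + smul (1 + \<tau>) v)"
    proof cases
      case 1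
      then show ?thesis by (rule combination_ge[OF assms(1,2,5,7,6) le2(1)])
    next
      case 2
      \<comment> \<open>Exchanging \<open>u\<close> and \<open>v\<close> replaces \<open>S\<close> by \<open>- S\<close>.\<close>
      have "N (restricted_coeffs \<Phi> (- (- S)) u) \<le> \<epsilon>" using assms(5) by simp
      from combination_ge[OF assms(1,2,7) this assms(4) le2(2) 2] show ?thesis
        by (simp add: add.commute)
    qed
    then show ?thesis using \<open>0 < B\<close> z by (simp add: field_simps)
  qed
  then have "(A - 3 * \<epsilon>) / B \<le> phase_dist smul (u + v) (u - v)"
    unfolding phase_dist_def by (intro cINF_greatest) (auto intro: exI[of _ 1])
  then show ?thesis using \<open>0 < B\<close> by (simp add: field_simps)
qed

lemma lower_lipschitz_eq_0:
  assumes "infinite_dimensional smul"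
  shows "lower_lipschitz smul W N \<Phi> = 0"
proof -
  let ?lip = "\<lambda>\<alpha>. \<forall>x y. ereal (\<alpha> * phase_dist smul x y)
    \<le> ext_norm W N (measurement \<Phi> x - measurement \<Phi> y)"
  obtain A B where AB: "0 < A" "0 < B" "\<And>x. A * norm x \<le> N (coeffs \<Phi> x)"
    "\<And>x. N (coeffs \<Phi> x) \<le> B * norm x" by (rule frame_bounds) blast
  have "\<alpha> \<le> 0" if "0 \<le> \<alpha>" and lip: "?lip \<alpha>" for \<alpha>
  proof -
    have "\<alpha> * A \<le> 0 + e" if "0 < e" for e
    proof -
      \<comment> \<open>The estimate below leaves the error \<open>(4 B + 3 \<alpha>) \<epsilon>\<close>.\<close>
      define \<epsilon> where "\<epsilon> = e / (4 * B + 3 * \<alpha>)"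
      have den: "0 < 4 * B + 3 * \<alpha>" using AB(2) \<open>0 \<le> \<alpha>\<close> by simp
      then have "0 < \<epsilon>" using \<open>0 < e\<close> by (simp add: \<epsilon>_def)
      then obtain C u v where uv: "norm u = 1" "N (restricted_coeffs \<Phi> C u) \<le> \<epsilon>"
        "norm v = 1" "N (restricted_coeffs \<Phi> (- C) v) \<le> \<epsilon>"
        by (rule complementary_localized_unit_vectors[OF assms])
      let ?d = "phase_dist smul (u + v) (u - v)"
      have "ereal (\<alpha> * ?d) \<le> ereal (4 * \<epsilon>)"
        using lip measurement_diff_le[OF uv(2,4)] by (blast intro: order_trans)
      then have "B * (\<alpha> * ?d) \<le> B * (4 * \<epsilon>)" using AB(2) by simp
      moreover have "\<alpha> * (A - 3 * \<epsilon>) \<le> \<alpha> * (B * ?d)"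
        using phase_dist_ge[OF AB(3,4,2) uv] \<open>0 \<le> \<alpha>\<close> by (rule mult_left_mono)
      ultimately have "\<alpha> * A \<le> \<epsilon> * (4 * B + 3 * \<alpha>)" by (simp add: algebra_simps)
      then show ?thesis using den by (simp add: \<epsilon>_def)
    qed
    then have "\<alpha> * A \<le> 0" by (rule field_le_epsilon)
    then show ?thesis using AB(1) by (simp add: mult_le_0_iff)
  qed
  moreover have "?lip 0" by (auto simp: ext_norm_def intro: N_nonneg)
  ultimately show ?thesis
    unfolding lower_lipschitz_def
    by (intro antisym Sup_least Sup_upper) (auto simp: zero_ereal_def)
qed

end

theorem theorem3p13:
  fixes smul :: "'k::real_or_complex \<Rightarrow> 'b::banach \<Rightarrow> 'b"
    and W :: "('l::topological_space \<Rightarrow> 'k) set"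
    and N :: "('l \<Rightarrow> 'k) \<Rightarrow> real"
  assumes "banach_space_over smul"
    and "infinite_dimensional smul"
    and "reflexive smul"
    and "sigma_compact (UNIV :: 'l set)"
    and "admissible_banach_space W N"
  shows "(\<forall>\<Phi>. frame smul W N \<Phi> \<and> upper_frame_bound W N \<Phi> < \<infinity> \<longrightarrow> scp_constant W N \<Phi> = 0) \<and>
    (INF \<Phi> \<in> {\<Phi>. frame smul W N \<Phi> \<and> upper_frame_bound W N \<Phi> < \<infinity>}.
       condition_number smul W N \<Phi>) = \<infinity>"
proof -
  have framed: "framed_banach_space smul W N \<Phi>" if "frame smul W N \<Phi>" for \<Phi>
    using that assms(1,5) by (simp add: framed_banach_space_def framed_banach_space_axioms_def)
  have "condition_number smul W N \<Phi> = \<infinity>" if "frame smul W N \<Phi>" for \<Phi>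
    using framed_banach_space.lower_lipschitz_eq_0[OF framed[OF that] assms(2)]
    by (simp add: condition_number_def)
  then have "(INF \<Phi> \<in> {\<Phi>. frame smul W N \<Phi> \<and> upper_frame_bound W N \<Phi> < \<infinity>}.
       condition_number smul W N \<Phi>) = \<infinity>"
    unfolding top_ereal_def[symmetric] by (intro INF_eqI) auto
  then show ?thesis
    using framed_banach_space.scp_constant_eq_0[OF framed assms(2)] by blast
qed

end
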